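(* Let $H\in(\frac12,1)$ and $\alpha_1,\alpha_2\in\mathbb R$. Consider a standard Ornstein-Uhlenbeck process with kernel $K_1(t,u):=e^{\alpha_1(t-u)}$ and a fractional Ornstein-Uhlenbeck process with kernel $$K_2(t,u):=c_Hu^{\frac12-H}\int_u^te^{\alpha_2(t-s)}\varphi_H(s,u)\,ds,\qquad \varphi_H(s,u)=s^{H-\frac12}(s-u)^{H-\frac32}.$$ If $\alpha_1\le\alpha_2$, then for all $0<u<T_1<T_2$, $$\begin{vmatrix} e^{\alpha_1(T_1-u)} & u^{\frac12-H}\int_u^{T_1}e^{\alpha_2(T_1-s)}\varphi_H(s,u)\,ds\\[4pt] e^{\alpha_1(T_2-u)} & u^{\frac12-H}\int_u^{T_2}e^{\alpha_2(T_2-s)}\varphi_H(s,u)\,ds \end{vmatrix}\neq0.$$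
   Context: The constant is $c_H=\left(H-\frac12\right)\left(\frac{2H\,\Gamma(\frac32-H)}{\Gamma(H+\frac12)\Gamma(2-2H)}\right)^{\frac12}>0$; it is omitted from the determinant. *)

theory Defs
  imports "HOL-Analysis.Analysis"
begin

definition ou_kernel :: "real \<Rightarrow> real \<Rightarrow> real \<Rightarrow> real" where
  "ou_kernel \<alpha> t u = exp (\<alpha> * (t - u))"

text \<open>For \<open>H < 3/2\<close> the factor \<open>(s - u) powr (H - 3/2)\<close> is unbounded as \<open>s\<close> decreases to \<open>u\<close>.
  At \<open>s = u\<close> itself it is \<open>0\<close>, by the convention \<open>0 powr a = 0\<close>; this is a single point and
  does not affect the integrals below.\<close>

definition phi :: "real \<Rightarrow> real \<Rightarrow> real \<Rightarrow> real" where
  "phi H s u = s powr (H - 1/2) * (s - u) powr (H - 3/2)"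

text \<open>The kernel of the fractional Ornstein-Uhlenbeck process without its constant \<open>c_H H\<close>.
  For \<open>1/2 < H < 1\<close> and \<open>0 < u < t\<close> the integrand is nonnegative and integrable over \<open>{u..t}\<close>, so
  this gauge integral is the Lebesgue integral.\<close>

definition fou_kernel_unnormalized :: "real \<Rightarrow> real \<Rightarrow> real \<Rightarrow> real \<Rightarrow> real" where
  "fou_kernel_unnormalized H \<alpha> t u =
     u powr (1/2 - H) * integral {u..t} (\<lambda>s. exp (\<alpha> * (t - s)) * phi H s u)"

definition c_H :: "real \<Rightarrow> real" where
  "c_H H = (H - 1/2) *
     (2 * H * Gamma (3/2 - H) / (Gamma (H + 1/2) * Gamma (2 - 2 * H))) powr (1/2)"

definition fou_kernel :: "real \<Rightarrow> real \<Rightarrow> real \<Rightarrow> real \<Rightarrow> real" where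
  "fou_kernel H \<alpha> t u = c_H H * fou_kernel_unnormalized H \<alpha> t u"

lemma c_H_pos: "c_H H > 0" if "1/2 < H" "H < 1"
proof -
  have "Gamma (3/2 - H) > 0" "Gamma (H + 1/2) > 0" "Gamma (2 - 2 * H) > 0"
    using that by (auto intro!: Gamma_real_pos)
  then have "(2 * H * Gamma (3/2 - H) / (Gamma (H + 1/2) * Gamma (2 - 2 * H))) powr (1/2) > 0"
    using that by (auto simp only: powr_gt_zero divide_eq_0_iff mult_eq_0_iff)
  with that show ?thesis
    unfolding c_H_def by (intro mult_pos_pos; linarith)
qed

text \<open>The constant \<open>c_H H\<close> can be dropped from the determinant: it only scales the second column.\<close>

lemma det_fou_kernel:
  "det (vector [vector [ou_kernel \<alpha>1 T1 u, fou_kernel H \<alpha>2 T1 u],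
                vector [ou_kernel \<alpha>1 T2 u, fou_kernel H \<alpha>2 T2 u]] :: real^2^2) =
   c_H H *
   det (vector [vector [ou_kernel \<alpha>1 T1 u, fou_kernel_unnormalized H \<alpha>2 T1 u],
                vector [ou_kernel \<alpha>1 T2 u, fou_kernel_unnormalized H \<alpha>2 T2 u]] :: real^2^2)"
  by (simp add: det_2 fou_kernel_def algebra_simps)

end

theory Submission
  imports Defs
begin

text \<open>Up to a positive factor the determinant is \<open>g T2 - g T1\<close>, where
  \<open>g T = exp ((\<alpha>2 - \<alpha>1) * T) * \<integral>\<^sub>u\<^sup>T exp (- \<alpha>2 * s) * \<phi>\<^sub>H(s,u) ds\<close> is a product of a
  positive nondecreasing function and a nonnegative strictly increasing one.\<close>

text \<open>For \<open>a < 0\<close> the integrand blows up at \<open>u\<close>, but its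
  antiderivative \<open>(s - u) powr (a + 1) / (a + 1)\<close> is continuous up to \<open>u\<close>
  because \<open>a + 1 > 0\<close>; the fundamental theorem then asks for the derivative on the open
  interval only.\<close>

lemma powr_shift_integrable:
  fixes a u t :: real
  assumes "-1 < a" "u \<le> t"
  shows "(\<lambda>s. (s - u) powr a) integrable_on {u..t}"
proof -
  have "((\<lambda>s. (s - u) powr a) has_integral
      ((t - u) powr (a + 1) / (a + 1) - (u - u) powr (a + 1) / (a + 1))) {u..t}"
  proof (rule fundamental_theorem_of_calculus_interior)
    show "continuous_on {u..t} (\<lambda>s. (s - u) powr (a + 1) / (a + 1))"
      using assms by (intro continuous_intros continuous_on_powr') auto
    show "((\<lambda>s. (s - u) powr (a + 1) / (a + 1)) has_vector_derivative (x - u) powr a) (at x)"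
      if "x \<in> {u<..<t}" for x
      using that assms
      by (auto intro!: derivative_eq_intros
          simp: has_real_derivative_iff_has_vector_derivative[symmetric])
  qed (use assms in auto)
  then show ?thesis by blast
qed

text \<open>The integrand is a factor \<open>g\<close>, continuous and hence bounded on the compact
  interval, times a singular power.\<close>

lemma exp_phi_integrable:
  assumes "1/2 < H" "0 < u" "u \<le> t"
  shows "(\<lambda>s. exp (- (\<alpha> * s)) * phi H s u) integrable_on {u..t}"
proof -
  define g where "g s = exp (- (\<alpha> * s)) * s powr (H - 1/2)" for s
  have cont: "continuous_on {u..t} g"
    unfolding g_def using assms by (intro continuous_intros) auto
  have "(\<lambda>s. g s * (s - u) powr (H - 3/2)) absolutely_integrable_on {u..t}"
  proof (rule absolutely_integrable_bounded_measurable_product_real)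
    show "g \<in> borel_measurable (lebesgue_on {u..t})"
      using cont by (intro continuous_imp_measurable_on_sets_lebesgue) auto
    show "bounded (g ` {u..t})"
      using cont by (intro compact_imp_bounded compact_continuous_image) auto
    \<comment> \<open>Here \<open>1/2 < H\<close> gives \<open>H - 3/2 > -1\<close>; nonnegativity
      turns integrability into absolute integrability.\<close>
    show "(\<lambda>s. (s - u) powr (H - 3/2)) absolutely_integrable_on {u..t}"
      using assms by (intro nonnegative_absolutely_integrable_1 powr_shift_integrable) auto
  qed auto
  then have "(\<lambda>s. g s * (s - u) powr (H - 3/2)) integrable_on {u..t}"
    by (rule set_lebesgue_integral_eq_integral(1))
  then show ?thesis
    by (simp add: g_def phi_def mult.assoc)
qed

lemma exp_phi_integral_strict_mono:
  assumes "1/2 < H" "0 < u" "u < T1" "T1 < T2"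
  shows "integral {u..T1} (\<lambda>s. exp (- (\<alpha> * s)) * phi H s u)
       < integral {u..T2} (\<lambda>s. exp (- (\<alpha> * s)) * phi H s u)"
proof -
  let ?f = "\<lambda>s. exp (- (\<alpha> * s)) * phi H s u"
  \<comment> \<open>Since \<open>u < T1\<close>, this interval avoids the singularity, so
    \<open>?f\<close> is continuous and positive on it.\<close>
  have "integral {T1..T2} (\<lambda>_. 0) < integral {T1..T2} ?f"
  proof (rule integral_less_real)
    show "continuous_on {T1..T2} ?f"
      unfolding phi_def using assms by (intro continuous_intros) auto
  qed (use assms in \<open>auto simp: phi_def\<close>)
  moreover have "integral {u..T1} ?f + integral {T1..T2} ?f = integral {u..T2} ?f"
    using assms by (intro Henstock_Kurzweil_Integration.integral_combine exp_phi_integrable) auto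
  ultimately show ?thesis by simp
qed

text \<open>Splitting off \<open>exp (\<alpha> * t)\<close> leaves an integrand free of
  \<open>t\<close>, so that the integrals in both rows of the determinant differ only in their upper
  limit.\<close>

lemma fou_kernel_unnormalized_factor:
  "fou_kernel_unnormalized H \<alpha> t u =
     u powr (1/2 - H) * (exp (\<alpha> * t) * integral {u..t} (\<lambda>s. exp (- (\<alpha> * s)) * phi H s u))"
proof -
  have "exp (\<alpha> * (t - s)) * phi H s u = exp (\<alpha> * t) * (exp (- (\<alpha> * s)) * phi H s u)" for s
    by (simp add: right_diff_distrib exp_diff exp_minus field_simps)
  then have "integral {u..t} (\<lambda>s. exp (\<alpha> * (t - s)) * phi H s u) =
      exp (\<alpha> * t) * integral {u..t} (\<lambda>s. exp (- (\<alpha> * s)) * phi H s u)"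
    by (simp only: integral_mult_right)
  then show ?thesis
    by (simp only: fou_kernel_unnormalized_def)
qed

theorem proposition21:
  fixes H \<alpha>1 \<alpha>2 u T1 T2 :: real
  assumes "1/2 < H" and "H < 1"
    and "\<alpha>1 \<le> \<alpha>2"
    and "0 < u" and "u < T1" and "T1 < T2"
  shows "det (vector
           [vector [ou_kernel \<alpha>1 T1 u, fou_kernel_unnormalized H \<alpha>2 T1 u],
            vector [ou_kernel \<alpha>1 T2 u, fou_kernel_unnormalized H \<alpha>2 T2 u]] :: real^2^2) \<noteq> 0"
proof -
  define I where "I t = integral {u..t} (\<lambda>s. exp (- (\<alpha>2 * s)) * phi H s u)" for t
  have I_less: "I T1 < I T2"
    unfolding I_def using assms by (intro exp_phi_integral_strict_mono)
  have I_nonneg: "0 \<le> I T1"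
    unfolding I_def using assms
    by (intro integral_nonneg exp_phi_integrable) (auto simp: phi_def)
  \<comment> \<open>The exponents of \<open>?b\<close> and \<open>?a\<close> differ by
    \<open>(\<alpha>2 - \<alpha>1) * (T2 - T1)\<close>, which is nonnegative.\<close>
  have "(\<alpha>2 - \<alpha>1) * T1 \<le> (\<alpha>2 - \<alpha>1) * T2"
    using assms by (intro mult_left_mono) auto
  then have "exp (\<alpha>1 * (T2 - u) + \<alpha>2 * T1) \<le> exp (\<alpha>1 * (T1 - u) + \<alpha>2 * T2)" (is "?a \<le> ?b")
    by (simp add: algebra_simps)
  then have "?a * I T1 \<le> ?b * I T1"
    using I_nonneg by (rule mult_right_mono)
  \<comment> \<open>Strictness comes from the integrals alone, so the case \<alpha>1 = \<alpha>2 is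
    covered.\<close>
  also have "\<dots> < ?b * I T2"
    using I_less by simp
  finally have "0 < u powr (1/2 - H) * (?b * I T2 - ?a * I T1)"
    using assms by simp
  also have "\<dots> = det (vector
           [vector [ou_kernel \<alpha>1 T1 u, fou_kernel_unnormalized H \<alpha>2 T1 u],
            vector [ou_kernel \<alpha>1 T2 u, fou_kernel_unnormalized H \<alpha>2 T2 u]] :: real^2^2)"
    \<comment> \<open>\<open>?b\<close> and \<open>?a\<close> collect the exponentials of the main
      diagonal and of the antidiagonal, respectively.\<close>
    unfolding I_def exp_add
    by (simp add: det_2 ou_kernel_def fou_kernel_unnormalized_factor) (simp add: algebra_simps)
  finally show ?thesis by simp
qed

end
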